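(* Let $k\colon X\to A$, $p\colon A\to B$, $s\colon B\to A$ be a split extension in the category $\ell\mathbb{G}rp$ of lattice-ordered groups, i.e. morphisms such that $ps=id_B$ and $k$ is a kernel of $p$. Then the intersection $k(X)^{\perp}\cap s(B)$ of $s(B)$ with the centralizer $k(X)^{\perp}$ of $k(X)$ in $A$ is an ideal of $A$.
   Context: A lattice-ordered group is an algebra $(X,\cdot,e,(-)^{-1},\lor)$ such that $(X,\cdot,e,(-)^{-1})$ is a group, $(X,\lor)$ is a semilattice ($\lor$ is associative, commutative, idempotent), and $x(y\lor z)=xy\lor xz$, $(x\lor y)z=xz\lor yz$ for all $x,y,z$. Morphisms are the maps preserving the group product and $\lor$; this defines the category $\ell\mathbb{G}rp$. One sets $x\land y := (x^{-1}\lor y^{-1})^{-1}$, $|x| := x\lor x^{-1}$, and $x\le y\iff x\lor y=y$. For a non-empty subset $S$ of $A$, the polar is $S^{\perp} := \{x\in A\mid |x|\land|s|=e\text{ for each } s\in S\}$; for a subalgebra $S$ it is the centralizer of $S$ in $A$, i.e. the greatest subalgebra $T$ of $A$ for which there is a morphism $\varphi\colon S\times T\to A$ with $\varphi(x,e)=x$ and $\varphi(e,t)=t$ for all $x\in S$, $t\in T$. An ideal of $A$ is a subobject that is the kernel of some morphism; equivalently, a subalgebra that is normal as a subgroup and convex (if $a\le x\le b$ with $a,b$ in it and $x\in A$, then $x$ is in it). *)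

theory Defs
  imports "HOL-Algebra.Coset"
begin

record 'a lgroup = "'a monoid" +
  vee :: "'a \<Rightarrow> 'a \<Rightarrow> 'a" (infixl \<open>\<^bold>\<or>\<index>\<close> 60)

locale l_group = group L for L (structure) +
  assumes vee_closed [simp, intro]:
      "\<lbrakk>x \<in> carrier L; y \<in> carrier L\<rbrakk> \<Longrightarrow> x \<^bold>\<or> y \<in> carrier L"
    and vee_assoc:
      "\<lbrakk>x \<in> carrier L; y \<in> carrier L; z \<in> carrier L\<rbrakk> \<Longrightarrow> (x \<^bold>\<or> y) \<^bold>\<or> z = x \<^bold>\<or> (y \<^bold>\<or> z)"
    and vee_comm:
      "\<lbrakk>x \<in> carrier L; y \<in> carrier L\<rbrakk> \<Longrightarrow> x \<^bold>\<or> y = y \<^bold>\<or> x"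
    and vee_idem [simp]:
      "x \<in> carrier L \<Longrightarrow> x \<^bold>\<or> x = x"
    and mult_vee_distrib_left:
      "\<lbrakk>x \<in> carrier L; y \<in> carrier L; z \<in> carrier L\<rbrakk> \<Longrightarrow> x \<otimes> (y \<^bold>\<or> z) = x \<otimes> y \<^bold>\<or> x \<otimes> z"
    and mult_vee_distrib_right:
      "\<lbrakk>x \<in> carrier L; y \<in> carrier L; z \<in> carrier L\<rbrakk> \<Longrightarrow> (x \<^bold>\<or> y) \<otimes> z = x \<otimes> z \<^bold>\<or> y \<otimes> z"

definition wedge :: "('a, 'm) lgroup_scheme \<Rightarrow> 'a \<Rightarrow> 'a \<Rightarrow> 'a" (infixl \<open>\<^bold>\<and>\<index>\<close> 60)
  where "x \<^bold>\<and>\<^bsub>L\<^esub> y = inv\<^bsub>L\<^esub> (inv\<^bsub>L\<^esub> x \<^bold>\<or>\<^bsub>L\<^esub> inv\<^bsub>L\<^esub> y)"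

definition l_abs :: "('a, 'm) lgroup_scheme \<Rightarrow> 'a \<Rightarrow> 'a"
  where "l_abs L x = x \<^bold>\<or>\<^bsub>L\<^esub> inv\<^bsub>L\<^esub> x"

definition l_le :: "('a, 'm) lgroup_scheme \<Rightarrow> 'a \<Rightarrow> 'a \<Rightarrow> bool"
  where "l_le L x y \<longleftrightarrow> x \<^bold>\<or>\<^bsub>L\<^esub> y = y"

definition polar :: "('a, 'm) lgroup_scheme \<Rightarrow> 'a set \<Rightarrow> 'a set"
  where "polar L S = {x \<in> carrier L. \<forall>s\<in>S. l_abs L x \<^bold>\<and>\<^bsub>L\<^esub> l_abs L s = \<one>\<^bsub>L\<^esub>}"

definition l_hom :: "('a, 'm) lgroup_scheme \<Rightarrow> ('b, 'n) lgroup_scheme \<Rightarrow> ('a \<Rightarrow> 'b) set"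
  where "l_hom A B =
    {f \<in> hom A B. \<forall>x \<in> carrier A. \<forall>y \<in> carrier A. f (x \<^bold>\<or>\<^bsub>A\<^esub> y) = f x \<^bold>\<or>\<^bsub>B\<^esub> f y}"

text \<open>
  A kernel of \<open>p\<close> is an object \<open>X\<close> that \<open>k\<close> maps isomorphically onto the concrete kernel of \<open>p\<close>.
  The lemmas \<open>is_kernel_universal\<close> and \<open>is_kernel_of_universal\<close> below say that this is the
  categorical notion.
\<close>

definition is_kernel ::
  "('x, 'l) lgroup_scheme \<Rightarrow> ('a, 'm) lgroup_scheme \<Rightarrow> ('b, 'n) lgroup_scheme
    \<Rightarrow> ('x \<Rightarrow> 'a) \<Rightarrow> ('a \<Rightarrow> 'b) \<Rightarrow> bool"
  where "is_kernel X A B k p \<longleftrightarrow>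
    k \<in> l_hom X A \<and> inj_on k (carrier X) \<and> k ` carrier X = kernel A B p"

definition split_extension ::
  "('x, 'l) lgroup_scheme \<Rightarrow> ('a, 'm) lgroup_scheme \<Rightarrow> ('b, 'n) lgroup_scheme
    \<Rightarrow> ('x \<Rightarrow> 'a) \<Rightarrow> ('a \<Rightarrow> 'b) \<Rightarrow> ('b \<Rightarrow> 'a) \<Rightarrow> bool"
  where "split_extension X A B k p s \<longleftrightarrow>
    l_group X \<and> l_group A \<and> l_group B \<and>
    k \<in> l_hom X A \<and> p \<in> l_hom A B \<and> s \<in> l_hom B A \<and>
    (\<forall>b \<in> carrier B. p (s b) = b) \<and> is_kernel X A B k p"

text \<open>
  The codomain of the morphism can be taken on the type \<open>'a set\<close> without loss of generality:
  it is enough to consider quotients, whose elements are cosets.  By \<open>l_ideal_iff\<close> and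
  \<open>l_ideal_kernel\<close> below, the choice of the type is immaterial.
\<close>

definition l_ideal :: "'a set \<Rightarrow> ('a, 'm) lgroup_scheme \<Rightarrow> bool"
  where "l_ideal I A \<longleftrightarrow>
    (\<exists>(C :: 'a set lgroup) f. l_group C \<and> f \<in> l_hom A C \<and> I = kernel A C f)"

definition convex_normal_subalgebra :: "'a set \<Rightarrow> ('a, 'm) lgroup_scheme \<Rightarrow> bool"
  where "convex_normal_subalgebra I A \<longleftrightarrow>
    I \<lhd> A \<and> (\<forall>x \<in> I. \<forall>y \<in> I. x \<^bold>\<or>\<^bsub>A\<^esub> y \<in> I) \<and>
    (\<forall>a \<in> I. \<forall>b \<in> I. \<forall>x \<in> carrier A. l_le A a x \<and> l_le A x b \<longrightarrow> x \<in> I)"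

lemma l_homD:
  assumes "f \<in> l_hom A B"
  shows "f \<in> hom A B" "x \<in> carrier A \<Longrightarrow> f x \<in> carrier B"
    "\<lbrakk>x \<in> carrier A; y \<in> carrier A\<rbrakk> \<Longrightarrow> f (x \<otimes>\<^bsub>A\<^esub> y) = f x \<otimes>\<^bsub>B\<^esub> f y"
    "\<lbrakk>x \<in> carrier A; y \<in> carrier A\<rbrakk> \<Longrightarrow> f (x \<^bold>\<or>\<^bsub>A\<^esub> y) = f x \<^bold>\<or>\<^bsub>B\<^esub> f y"
  using assms by (auto simp: l_hom_def hom_def)

lemma l_hom_group_hom:
  "\<lbrakk>l_group A; l_group B; f \<in> l_hom A B\<rbrakk> \<Longrightarrow> group_hom A B f"
  by (simp add: group_hom_def group_hom_axioms_def l_group_def l_homD)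

lemma convex_normal_subalgebra_kernel:
  assumes A: "l_group A" and C: "l_group C" and f: "f \<in> l_hom A C"
  shows "convex_normal_subalgebra (kernel A C f) A"
proof -
  interpret A: l_group A by fact
  interpret C: l_group C by fact
  interpret group_hom A C f using A C f by (rule l_hom_group_hom)
  have "x \<in> kernel A C f"
    if "a \<in> kernel A C f" "b \<in> kernel A C f" "x \<in> carrier A" "l_le A a x" "l_le A x b" for a b x
  proof -
    have "f (a \<^bold>\<or>\<^bsub>A\<^esub> x) = f x" "f (x \<^bold>\<or>\<^bsub>A\<^esub> b) = f b"
      using that by (auto simp: l_le_def)
    then have "\<one>\<^bsub>C\<^esub> \<^bold>\<or>\<^bsub>C\<^esub> f x = f x" "f x \<^bold>\<or>\<^bsub>C\<^esub> \<one>\<^bsub>C\<^esub> = \<one>\<^bsub>C\<^esub>"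
      using that by (auto simp: kernel_def l_homD(4)[OF f])
    then show ?thesis
      using that by (simp add: kernel_def C.vee_comm[of "f x" "\<one>\<^bsub>C\<^esub>"])
  qed
  moreover have "x \<^bold>\<or>\<^bsub>A\<^esub> y \<in> kernel A C f"
    if "x \<in> kernel A C f" "y \<in> kernel A C f" for x y
    using that by (auto simp: kernel_def l_homD(4)[OF f])
  ultimately show ?thesis
    unfolding convex_normal_subalgebra_def using normal_kernel by blast
qed

definition l_quotient :: "('a, 'm) lgroup_scheme \<Rightarrow> 'a set \<Rightarrow> 'a set lgroup"
  where "l_quotient A I = \<lparr>carrier = rcosets\<^bsub>A\<^esub> I, mult = set_mult A, one = I,
    vee = (\<lambda>U V. \<Union>u\<in>U. \<Union>v\<in>V. I #>\<^bsub>A\<^esub> (u \<^bold>\<or>\<^bsub>A\<^esub> v))\<rparr>"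

lemma l_quotient:
  assumes A: "l_group A" and I: "convex_normal_subalgebra I A"
  shows "l_group (l_quotient A I)" "(\<lambda>x. I #>\<^bsub>A\<^esub> x) \<in> l_hom A (l_quotient A I)"
    "kernel A (l_quotient A I) (\<lambda>x. I #>\<^bsub>A\<^esub> x) = I"
proof -
  interpret A: l_group A by fact
  interpret N: normal I A using I unfolding convex_normal_subalgebra_def by blast
  let ?c = "\<lambda>x. I #>\<^bsub>A\<^esub> x"
  let ?Q = "l_quotient A I"
  have sub: "x \<in> carrier A" if "x \<in> I" for x using that by (rule N.mem_carrier)
  have vee_I: "x \<^bold>\<or>\<^bsub>A\<^esub> y \<in> I" if "x \<in> I" "y \<in> I" for x y
    using I that unfolding convex_normal_subalgebra_def by blast
  have conv: "x \<in> I" if "a \<in> I" "b \<in> I" "x \<in> carrier A" "l_le A a x" "l_le A x b" for a b x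
    using I that unfolding convex_normal_subalgebra_def by blast
  have le1: "l_le A x (x \<^bold>\<or>\<^bsub>A\<^esub> y)" "l_le A y (x \<^bold>\<or>\<^bsub>A\<^esub> y)"
    if "x \<in> carrier A" "y \<in> carrier A" for x y
    using that A.vee_assoc[of x x y] A.vee_assoc[of y y x] A.vee_comm[of x y]
    by (auto simp: l_le_def)
  have vee_least: "l_le A (x \<^bold>\<or>\<^bsub>A\<^esub> y) z"
    if "x \<in> carrier A" "y \<in> carrier A" "z \<in> carrier A" "l_le A x z" "l_le A y z" for x y z
    using that by (simp add: l_le_def A.vee_assoc)
  have trans: "l_le A x z"
    if "x \<in> carrier A" "y \<in> carrier A" "z \<in> carrier A" "l_le A x y" "l_le A y z" for x y z
    using that A.vee_assoc[of x y z] by (simp add: l_le_def)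
  have mono: "l_le A (x \<otimes>\<^bsub>A\<^esub> z) (y \<otimes>\<^bsub>A\<^esub> z)"
    if "x \<in> carrier A" "y \<in> carrier A" "z \<in> carrier A" "l_le A x y" for x y z
    using that by (simp add: l_le_def A.mult_vee_distrib_right[symmetric])
  have key: "l_le A (i \<otimes>\<^bsub>A\<^esub> x \<^bold>\<or>\<^bsub>A\<^esub> j \<otimes>\<^bsub>A\<^esub> y) ((i \<^bold>\<or>\<^bsub>A\<^esub> j) \<otimes>\<^bsub>A\<^esub> (x \<^bold>\<or>\<^bsub>A\<^esub> y))"
    if "i \<in> carrier A" "j \<in> carrier A" "x \<in> carrier A" "y \<in> carrier A" for i j x y
  proof -
    let ?d = "i \<^bold>\<or>\<^bsub>A\<^esub> j"
    have d: "?d \<otimes>\<^bsub>A\<^esub> (x \<^bold>\<or>\<^bsub>A\<^esub> y) = ?d \<otimes>\<^bsub>A\<^esub> x \<^bold>\<or>\<^bsub>A\<^esub> ?d \<otimes>\<^bsub>A\<^esub> y"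
      using that by (simp add: A.mult_vee_distrib_left)
    have "l_le A (i \<otimes>\<^bsub>A\<^esub> x) (?d \<otimes>\<^bsub>A\<^esub> x)" "l_le A (j \<otimes>\<^bsub>A\<^esub> y) (?d \<otimes>\<^bsub>A\<^esub> y)"
      using that by (auto intro!: mono le1)
    then have "l_le A (i \<otimes>\<^bsub>A\<^esub> x) (?d \<otimes>\<^bsub>A\<^esub> x \<^bold>\<or>\<^bsub>A\<^esub> ?d \<otimes>\<^bsub>A\<^esub> y)"
      "l_le A (j \<otimes>\<^bsub>A\<^esub> y) (?d \<otimes>\<^bsub>A\<^esub> x \<^bold>\<or>\<^bsub>A\<^esub> ?d \<otimes>\<^bsub>A\<^esub> y)"
      using that le1[of "?d \<otimes>\<^bsub>A\<^esub> x" "?d \<otimes>\<^bsub>A\<^esub> y"]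
        trans[of "i \<otimes>\<^bsub>A\<^esub> x" "?d \<otimes>\<^bsub>A\<^esub> x" "?d \<otimes>\<^bsub>A\<^esub> x \<^bold>\<or>\<^bsub>A\<^esub> ?d \<otimes>\<^bsub>A\<^esub> y"]
        trans[of "j \<otimes>\<^bsub>A\<^esub> y" "?d \<otimes>\<^bsub>A\<^esub> y" "?d \<otimes>\<^bsub>A\<^esub> x \<^bold>\<or>\<^bsub>A\<^esub> ?d \<otimes>\<^bsub>A\<^esub> y"]
      by auto
    then show ?thesis using that by (simp add: d vee_least)
  qed
  have shift: "l_le A (z \<otimes>\<^bsub>A\<^esub> inv\<^bsub>A\<^esub> w) d"
    if "z \<in> carrier A" "w \<in> carrier A" "d \<in> carrier A" "l_le A z (d \<otimes>\<^bsub>A\<^esub> w)" for z w d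
    using mono[of z "d \<otimes>\<^bsub>A\<^esub> w" "inv\<^bsub>A\<^esub> w"] that by (simp add: A.m_assoc)
  have shift': "l_le A (inv\<^bsub>A\<^esub> d) (w \<otimes>\<^bsub>A\<^esub> inv\<^bsub>A\<^esub> z)"
    if "z \<in> carrier A" "w \<in> carrier A" "d \<in> carrier A" "l_le A z (d \<otimes>\<^bsub>A\<^esub> w)" for z w d
  proof -
    have cancel: "inv\<^bsub>A\<^esub> d \<otimes>\<^bsub>A\<^esub> (d \<otimes>\<^bsub>A\<^esub> v) = v" if "v \<in> carrier A" for v
      using that \<open>d \<in> carrier A\<close> by (simp add: A.m_assoc[symmetric])
    have 1: "z \<^bold>\<or>\<^bsub>A\<^esub> d \<otimes>\<^bsub>A\<^esub> w = d \<otimes>\<^bsub>A\<^esub> w" using that by (simp add: l_le_def)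
    have "inv\<^bsub>A\<^esub> d \<otimes>\<^bsub>A\<^esub> ((z \<^bold>\<or>\<^bsub>A\<^esub> d \<otimes>\<^bsub>A\<^esub> w) \<otimes>\<^bsub>A\<^esub> inv\<^bsub>A\<^esub> z) =
      inv\<^bsub>A\<^esub> d \<^bold>\<or>\<^bsub>A\<^esub> w \<otimes>\<^bsub>A\<^esub> inv\<^bsub>A\<^esub> z"
      using that
      by (simp add: A.mult_vee_distrib_left A.mult_vee_distrib_right A.m_assoc cancel)
    moreover have "inv\<^bsub>A\<^esub> d \<otimes>\<^bsub>A\<^esub> ((z \<^bold>\<or>\<^bsub>A\<^esub> d \<otimes>\<^bsub>A\<^esub> w) \<otimes>\<^bsub>A\<^esub> inv\<^bsub>A\<^esub> z) = w \<otimes>\<^bsub>A\<^esub> inv\<^bsub>A\<^esub> z"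
      unfolding 1 using that by (simp add: A.m_assoc cancel)
    ultimately show ?thesis by (simp add: l_le_def)
  qed
  have c_eq: "?c x = ?c y" if "x \<in> I #>\<^bsub>A\<^esub> y" "y \<in> carrier A" for x y
    using A.repr_independence[OF that] N.is_subgroup by simp
  have vee_mem: "u \<^bold>\<or>\<^bsub>A\<^esub> v \<in> I #>\<^bsub>A\<^esub> (x \<^bold>\<or>\<^bsub>A\<^esub> y)"
    if uc: "u \<in> ?c x" and vc: "v \<in> ?c y" and xy: "x \<in> carrier A" "y \<in> carrier A" for u v x y
  proof -
    obtain i where i: "i \<in> I" "u = i \<otimes>\<^bsub>A\<^esub> x"
      using uc unfolding r_coset_def by blast
    obtain j where j: "j \<in> I" "v = j \<otimes>\<^bsub>A\<^esub> y"
      using vc unfolding r_coset_def by blast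
    note ij = i j
    have carr: "i \<in> carrier A" "j \<in> carrier A" using ij sub by auto
    let ?w = "x \<^bold>\<or>\<^bsub>A\<^esub> y" and ?z = "u \<^bold>\<or>\<^bsub>A\<^esub> v" and ?d = "i \<^bold>\<or>\<^bsub>A\<^esub> j"
    let ?e = "inv\<^bsub>A\<^esub> i \<^bold>\<or>\<^bsub>A\<^esub> inv\<^bsub>A\<^esub> j"
    have uv: "u \<in> carrier A" "v \<in> carrier A" using ij carr that by auto
    have "x = inv\<^bsub>A\<^esub> i \<otimes>\<^bsub>A\<^esub> u" "y = inv\<^bsub>A\<^esub> j \<otimes>\<^bsub>A\<^esub> v"
      using ij carr that uv by (auto simp: A.inv_solve_left)
    then have "l_le A ?w (?e \<otimes>\<^bsub>A\<^esub> ?z)"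
      using key[of "inv\<^bsub>A\<^esub> i" "inv\<^bsub>A\<^esub> j" u v] carr uv by simp
    then have "l_le A (inv\<^bsub>A\<^esub> ?e) (?z \<otimes>\<^bsub>A\<^esub> inv\<^bsub>A\<^esub> ?w)"
      using carr uv that by (intro shift') auto
    moreover have "l_le A (?z \<otimes>\<^bsub>A\<^esub> inv\<^bsub>A\<^esub> ?w) ?d"
      using key[of i j x y] carr uv that ij by (intro shift) auto
    moreover have "?d \<in> I" "inv\<^bsub>A\<^esub> ?e \<in> I" using ij by (auto intro: vee_I)
    moreover have "?z \<otimes>\<^bsub>A\<^esub> inv\<^bsub>A\<^esub> ?w \<in> carrier A" using uv xy by simp
    ultimately have "?z \<otimes>\<^bsub>A\<^esub> inv\<^bsub>A\<^esub> ?w \<in> I"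
      using conv[of "inv\<^bsub>A\<^esub> ?e" ?d] by blast
    moreover have "?z = (?z \<otimes>\<^bsub>A\<^esub> inv\<^bsub>A\<^esub> ?w) \<otimes>\<^bsub>A\<^esub> ?w"
      using uv that by (simp add: A.m_assoc)
    ultimately show ?thesis unfolding r_coset_def by blast
  qed
  have self: "x \<in> ?c x" if "x \<in> carrier A" for x
    using A.rcos_self[OF that N.is_subgroup] .
  have veeQ: "?c x \<^bold>\<or>\<^bsub>?Q\<^esub> ?c y = ?c (x \<^bold>\<or>\<^bsub>A\<^esub> y)"
    if xy: "x \<in> carrier A" "y \<in> carrier A" for x y
  proof -
    have "?c (u \<^bold>\<or>\<^bsub>A\<^esub> v) = ?c (x \<^bold>\<or>\<^bsub>A\<^esub> y)" if "u \<in> ?c x" "v \<in> ?c y" for u v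
      using c_eq[OF vee_mem[OF that xy]] xy by simp
    then have "?c x \<^bold>\<or>\<^bsub>?Q\<^esub> ?c y = (\<Union>u\<in>?c x. \<Union>v\<in>?c y. ?c (x \<^bold>\<or>\<^bsub>A\<^esub> y))"
      unfolding l_quotient_def lgroup.select_convs by (intro SUP_cong refl) blast
    also have "\<dots> = ?c (x \<^bold>\<or>\<^bsub>A\<^esub> y)"
      using self[OF xy(1)] self[OF xy(2)] by blast
    finally show ?thesis .
  qed
  have multQ: "?c x \<otimes>\<^bsub>?Q\<^esub> ?c y = ?c (x \<otimes>\<^bsub>A\<^esub> y)"
    if "x \<in> carrier A" "y \<in> carrier A" for x y
    using that by (simp add: l_quotient_def N.rcos_sum)
  have carrQ: "carrier ?Q = ?c ` carrier A"
    by (auto simp: l_quotient_def RCOSETS_def)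
  have "group ?Q"
    using N.factorgroup_is_group
    by (simp add: l_quotient_def FactGroup_def group_def monoid_def group_axioms_def Units_def)
  moreover have "l_group_axioms ?Q"
    by (unfold l_group_axioms_def carrQ, intro conjI allI impI; elim imageE)
      (simp_all add: veeQ multQ A.vee_assoc A.mult_vee_distrib_left A.mult_vee_distrib_right,
       simp add: A.vee_comm)
  ultimately show "l_group ?Q" by (rule l_group.intro)
  show "?c \<in> l_hom A ?Q"
    by (auto simp: l_hom_def hom_def carrQ veeQ multQ)
  show "kernel A ?Q ?c = I"
    using A.coset_join1[OF _ _ N.is_subgroup] A.coset_join2[OF _ N.is_subgroup] sub
    by (auto simp: kernel_def l_quotient_def)
qed

lemma l_ideal_iff:
  assumes "l_group A"
  shows "l_ideal I A \<longleftrightarrow> convex_normal_subalgebra I A"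
  using convex_normal_subalgebra_kernel[OF assms] l_quotient[OF assms]
  unfolding l_ideal_def by metis

lemma l_ideal_kernel:
  assumes "l_group A" "l_group C" "f \<in> l_hom A C"
  shows "l_ideal (kernel A C f) A"
  using assms by (simp add: l_ideal_iff convex_normal_subalgebra_kernel)

lemma is_kernel_universal:
  assumes X: "l_group X" and A: "l_group A" and T: "l_group T" and k: "is_kernel X A B k p"
    and h: "h \<in> l_hom T A" and ph: "\<And>t. t \<in> carrier T \<Longrightarrow> p (h t) = \<one>\<^bsub>B\<^esub>"
  shows "\<exists>u \<in> l_hom T X. (\<forall>t \<in> carrier T. k (u t) = h t) \<and>
    (\<forall>u' \<in> l_hom T X. (\<forall>t \<in> carrier T. k (u' t) = h t) \<longrightarrow> (\<forall>t \<in> carrier T. u' t = u t))"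
proof -
  interpret X: l_group X by fact
  interpret A: l_group A by fact
  interpret T: l_group T by fact
  have kh: "k \<in> l_hom X A" and inj: "inj_on k (carrier X)" and im: "k ` carrier X = kernel A B p"
    using k by (auto simp: is_kernel_def)
  define u where "u = inv_into (carrier X) k \<circ> h"
  have ht: "h t \<in> k ` carrier X" if "t \<in> carrier T" for t
    using that ph h by (auto simp: im kernel_def dest: l_homD(2))
  have uX: "u t \<in> carrier X" and ku: "k (u t) = h t" if "t \<in> carrier T" for t
    using ht[OF that] by (auto simp: u_def inv_into_into f_inv_into_f)
  have "u (x \<otimes>\<^bsub>T\<^esub> y) = u x \<otimes>\<^bsub>X\<^esub> u y" "u (x \<^bold>\<or>\<^bsub>T\<^esub> y) = u x \<^bold>\<or>\<^bsub>X\<^esub> u y"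
    if "x \<in> carrier T" "y \<in> carrier T" for x y
    using that by (auto intro!: inj_onD[OF inj] simp: uX ku l_homD[OF kh] l_homD[OF h])
  then have "u \<in> l_hom T X"
    using uX by (auto simp: l_hom_def hom_def)
  moreover have "u' t = u t"
    if "u' \<in> l_hom T X" "\<forall>t \<in> carrier T. k (u' t) = h t" "t \<in> carrier T" for u' t
    using that by (auto intro!: inj_onD[OF inj] simp: uX ku l_homD(2))
  ultimately show ?thesis using ku by blast
qed

lemma is_kernel_of_universal:
  fixes X :: "('x, 'l) lgroup_scheme" and A :: "('a, 'm) lgroup_scheme"
    and B :: "('b, 'n) lgroup_scheme"
  assumes X: "l_group X" and A: "l_group A" and B: "l_group B"
    and p: "p \<in> l_hom A B" and k: "k \<in> l_hom X A"
    and pk: "\<And>x. x \<in> carrier X \<Longrightarrow> p (k x) = \<one>\<^bsub>B\<^esub>"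
    and ex: "\<And>(T :: ('a, 'm) lgroup_scheme) h.
      \<lbrakk>l_group T; h \<in> l_hom T A; \<And>t. t \<in> carrier T \<Longrightarrow> p (h t) = \<one>\<^bsub>B\<^esub>\<rbrakk>
        \<Longrightarrow> \<exists>u \<in> l_hom T X. \<forall>t \<in> carrier T. k (u t) = h t"
    and uniq: "\<And>(T :: ('x, 'l) lgroup_scheme) u u'.
      \<lbrakk>l_group T; u \<in> l_hom T X; u' \<in> l_hom T X; \<And>t. t \<in> carrier T \<Longrightarrow> k (u t) = k (u' t)\<rbrakk>
        \<Longrightarrow> \<forall>t \<in> carrier T. u t = u' t"
  shows "is_kernel X A B k p"
proof -
  interpret A: l_group A by fact
  interpret p: group_hom A B p using A B p by (rule l_hom_group_hom)
  let ?K = "A\<lparr>carrier := kernel A B p\<rparr>"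
  have K: "convex_normal_subalgebra (kernel A B p) A"
    using A B p by (rule convex_normal_subalgebra_kernel)
  have sub: "kernel A B p \<subseteq> carrier A" by (auto simp: kernel_def)
  have "group ?K"
    using A.subgroup_imp_group[OF p.subgroup_kernel] .
  moreover have "x \<in> carrier A" if "x \<in> kernel A B p" for x using that sub by blast
  moreover have "x \<^bold>\<or>\<^bsub>A\<^esub> y \<in> kernel A B p"
    if "x \<in> kernel A B p" "y \<in> kernel A B p" for x y
    using K that unfolding convex_normal_subalgebra_def by blast
  ultimately have lK: "l_group ?K"
    by (simp add: l_group_def l_group_axioms_def A.vee_assoc A.mult_vee_distrib_left A.mult_vee_distrib_right)
      (blast intro: A.vee_comm)
  have "(\<lambda>x. x) \<in> l_hom ?K A"
    using sub by (auto simp: l_hom_def hom_def)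
  from ex[OF lK this] obtain u where u: "u \<in> l_hom ?K X" "\<forall>t \<in> kernel A B p. k (u t) = t"
    by (auto simp: kernel_def)
  have kK: "k x \<in> kernel A B p" if "x \<in> carrier X" for x
    using that pk l_homD(2)[OF k] by (auto simp: kernel_def)
  have uX: "u t \<in> carrier X" if "t \<in> kernel A B p" for t
    using l_homD(2)[OF u(1)] that by simp
  have "k ` carrier X = kernel A B p"
    using kK u(2) uX by (force simp: image_iff)
  moreover have "inj_on k (carrier X)"
  proof -
    have "u \<circ> k \<in> l_hom X X" "(\<lambda>x. x) \<in> l_hom X X"
      using kK uX l_homD[OF u(1)] l_homD[OF k] by (auto simp: l_hom_def hom_def)
    from uniq[OF X this] have "\<forall>x \<in> carrier X. u (k x) = x"
      using u(2) kK by simp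
    then show ?thesis by (auto intro: inj_on_inverseI)
  qed
  ultimately show ?thesis using k by (simp add: is_kernel_def)
qed

end

(* Write K for the kernel of p and J for its polar.  J is an ideal, and it meets K trivially.
   Hence if both x and s (p x) lie in J, then x (s (p x))^-1, which lies in K and in J, is trivial.
   So the intersection of J with the image of s is the intersection of the two ideals J and
   (s o p)^-1 J. *)

theory Submission
  imports Defs
begin

context l_group
begin

section \<open>The order of a lattice-ordered group and its compatibility with products and
  inverses\<close>

abbreviation le (infix \<open>\<preceq>\<close> 50) where "x \<preceq> y \<equiv> l_le L x y"

lemma wedge_closed [simp, intro]: "\<lbrakk>x \<in> carrier L; y \<in> carrier L\<rbrakk> \<Longrightarrow> x \<^bold>\<and> y \<in> carrier L"
  by (simp add: wedge_def)

lemma l_abs_closed [simp, intro]: "x \<in> carrier L \<Longrightarrow> l_abs L x \<in> carrier L"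
  by (simp add: l_abs_def)

lemma le_refl [simp]: "x \<in> carrier L \<Longrightarrow> x \<preceq> x"
  by (simp add: l_le_def)

lemma le_antisym: "\<lbrakk>x \<preceq> y; y \<preceq> x; x \<in> carrier L; y \<in> carrier L\<rbrakk> \<Longrightarrow> x = y"
  using vee_comm[of x y] by (simp add: l_le_def)

lemma le_trans:
  "\<lbrakk>x \<preceq> y; y \<preceq> z; x \<in> carrier L; y \<in> carrier L; z \<in> carrier L\<rbrakk> \<Longrightarrow> x \<preceq> z"
  using vee_assoc[of x y z] by (simp add: l_le_def)

lemma le_vee1: "\<lbrakk>x \<in> carrier L; y \<in> carrier L\<rbrakk> \<Longrightarrow> x \<preceq> x \<^bold>\<or> y"
  using vee_assoc[of x x y] by (simp add: l_le_def)

lemma le_vee2: "\<lbrakk>x \<in> carrier L; y \<in> carrier L\<rbrakk> \<Longrightarrow> y \<preceq> x \<^bold>\<or> y"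
  using le_vee1[of y x] by (simp add: vee_comm)

lemma vee_le:
  "\<lbrakk>x \<preceq> z; y \<preceq> z; x \<in> carrier L; y \<in> carrier L; z \<in> carrier L\<rbrakk> \<Longrightarrow> x \<^bold>\<or> y \<preceq> z"
  by (simp add: l_le_def vee_assoc)

lemma mult_le_left:
  "\<lbrakk>x \<preceq> y; x \<in> carrier L; y \<in> carrier L; z \<in> carrier L\<rbrakk> \<Longrightarrow> z \<otimes> x \<preceq> z \<otimes> y"
  by (simp add: l_le_def mult_vee_distrib_left[symmetric])

lemma mult_le_right:
  "\<lbrakk>x \<preceq> y; x \<in> carrier L; y \<in> carrier L; z \<in> carrier L\<rbrakk> \<Longrightarrow> x \<otimes> z \<preceq> y \<otimes> z"
  by (simp add: l_le_def mult_vee_distrib_right[symmetric])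

lemma mult_le_mono:
  assumes "x \<preceq> x'" "y \<preceq> y'" "x \<in> carrier L" "x' \<in> carrier L" "y \<in> carrier L" "y' \<in> carrier L"
  shows "x \<otimes> y \<preceq> x' \<otimes> y'"
  using le_trans[OF mult_le_right[of x x' y] mult_le_left[of y y' x']] assms by simp

lemma le_mult_left:
  "\<lbrakk>\<one> \<preceq> z; x \<in> carrier L; z \<in> carrier L\<rbrakk> \<Longrightarrow> x \<preceq> z \<otimes> x"
  using mult_le_right[of \<one> z x] by simp

lemma le_mult_right:
  "\<lbrakk>\<one> \<preceq> z; x \<in> carrier L; z \<in> carrier L\<rbrakk> \<Longrightarrow> x \<preceq> x \<otimes> z"
  using mult_le_left[of \<one> z x] by simp

text \<open>Multiply \<open>x \<preceq> y\<close> by \<open>inv y\<close> on the left and by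
  \<open>inv x\<close> on the right. Inversion thus reverses the order, so the facts on meets follow
  from those on joins.\<close>

lemma inv_le:
  assumes "x \<preceq> y" "x \<in> carrier L" "y \<in> carrier L"
  shows "inv y \<preceq> inv x"
proof -
  have "inv y \<otimes> (x \<otimes> inv x) \<preceq> inv y \<otimes> (y \<otimes> inv x)"
    using assms by (intro mult_le_left mult_le_right) auto
  then show ?thesis
    using assms by (simp add: m_assoc[symmetric])
qed

lemma wedge_le1: "\<lbrakk>x \<in> carrier L; y \<in> carrier L\<rbrakk> \<Longrightarrow> x \<^bold>\<and> y \<preceq> x"
  using inv_le[OF le_vee1[of "inv x" "inv y"]] by (simp add: wedge_def)

lemma wedge_le2: "\<lbrakk>x \<in> carrier L; y \<in> carrier L\<rbrakk> \<Longrightarrow> x \<^bold>\<and> y \<preceq> y"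
  using inv_le[OF le_vee2[of "inv x" "inv y"]] by (simp add: wedge_def)

lemma le_wedge:
  "\<lbrakk>z \<preceq> x; z \<preceq> y; x \<in> carrier L; y \<in> carrier L; z \<in> carrier L\<rbrakk> \<Longrightarrow> z \<preceq> x \<^bold>\<and> y"
  using inv_le[OF vee_le[of "inv x" "inv z" "inv y"]] by (simp add: wedge_def inv_le)

lemma wedge_idem [simp]: "x \<in> carrier L \<Longrightarrow> x \<^bold>\<and> x = x"
  by (simp add: wedge_def)

text \<open>Inversion turns meets into joins and reverses products, so left distributivity over
  meets comes from right distributivity over joins, and vice versa in the next lemma.\<close>

lemma mult_wedge_distrib_left:
  assumes "x \<in> carrier L" "y \<in> carrier L" "z \<in> carrier L"
  shows "x \<otimes> (y \<^bold>\<and> z) = x \<otimes> y \<^bold>\<and> x \<otimes> z"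
proof -
  have "x \<otimes> (y \<^bold>\<and> z) = inv ((inv y \<^bold>\<or> inv z) \<otimes> inv x)"
    using assms by (simp add: wedge_def inv_mult_group)
  then show ?thesis
    using assms by (simp add: wedge_def mult_vee_distrib_right inv_mult_group)
qed

lemma mult_wedge_distrib_right:
  assumes "x \<in> carrier L" "y \<in> carrier L" "z \<in> carrier L"
  shows "(x \<^bold>\<and> y) \<otimes> z = x \<otimes> z \<^bold>\<and> y \<otimes> z"
proof -
  have "(x \<^bold>\<and> y) \<otimes> z = inv (inv z \<otimes> (inv x \<^bold>\<or> inv y))"
    using assms by (simp add: wedge_def inv_mult_group)
  then show ?thesis
    using assms by (simp add: wedge_def mult_vee_distrib_left inv_mult_group)
qed

section \<open>Absolute values\<close>

lemma le_l_abs: "x \<in> carrier L \<Longrightarrow> x \<preceq> l_abs L x"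
  by (simp add: l_abs_def le_vee1)

lemma inv_le_l_abs: "x \<in> carrier L \<Longrightarrow> inv x \<preceq> l_abs L x"
  by (simp add: l_abs_def le_vee2)

lemma l_abs_inv: "x \<in> carrier L \<Longrightarrow> l_abs L (inv x) = l_abs L x"
  by (simp add: l_abs_def vee_comm)

lemma l_abs_le:
  "\<lbrakk>x \<preceq> u; inv x \<preceq> u; x \<in> carrier L; u \<in> carrier L\<rbrakk> \<Longrightarrow> l_abs L x \<preceq> u"
  by (simp add: l_abs_def vee_le)

lemma one_le_of_square:
  assumes y: "y \<in> carrier L" and "\<one> \<preceq> y \<otimes> y"
  shows "\<one> \<preceq> y"
proof -
  let ?d = "y \<^bold>\<and> \<one>"
  have d: "?d \<in> carrier L" using y by simp
  \<comment> \<open>\<open>d\<close> is below each of \<open>y\<^sup>2\<close>, \<open>y\<close>, \<open>\<one>\<close>, whose meet is \<open>d\<^sup>2\<close>; cancel \<open>d\<close>.\<close>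
  have "?d \<preceq> y \<otimes> y" "?d \<preceq> y" "?d \<preceq> \<one>"
    using assms le_trans[OF wedge_le2[of y \<one>], of "y \<otimes> y"] by (auto simp: wedge_le1 wedge_le2)
  then have "?d \<preceq> (y \<otimes> y \<^bold>\<and> y) \<^bold>\<and> (y \<^bold>\<and> \<one>)"
    using y by (intro le_wedge) auto
  moreover have "?d \<otimes> ?d = (y \<otimes> y \<^bold>\<and> y) \<^bold>\<and> (y \<^bold>\<and> \<one>)"
    using y by (simp add: mult_wedge_distrib_right[of y \<one> ?d] mult_wedge_distrib_left[of y y \<one>])
  ultimately have "?d \<preceq> ?d \<otimes> ?d"
    by simp
  then have "inv ?d \<otimes> ?d \<preceq> inv ?d \<otimes> (?d \<otimes> ?d)"
    using d by (intro mult_le_left) auto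
  then have "\<one> \<preceq> ?d"
    using d by (simp add: m_assoc[symmetric])
  then show ?thesis
    using le_trans[OF _ wedge_le1[of y \<one>]] y by simp
qed

text \<open>Both \<open>x\<close> and \<open>inv x\<close> lie below \<open>l_abs L x\<close>, so
  their product, the identity, lies below its square; \<open>one_le_of_square\<close> then removes
  the square.\<close>

lemma one_le_l_abs:
  assumes "x \<in> carrier L"
  shows "\<one> \<preceq> l_abs L x"
proof (rule one_le_of_square)
  show "\<one> \<preceq> l_abs L x \<otimes> l_abs L x"
    using mult_le_mono[OF le_l_abs inv_le_l_abs, of x x] assms by simp
qed (use assms in simp)

text \<open>Both \<open>x\<close> and \<open>inv x\<close> lie below the absolute value, hence below
  the identity; inverting the second inequality puts \<open>x\<close> above it as well.\<close>

lemma l_abs_eq_one: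
  assumes "x \<in> carrier L" "l_abs L x = \<one>"
  shows "x = \<one>"
proof (rule le_antisym)
  show "x \<preceq> \<one>" using le_l_abs[of x] assms by simp
  show "\<one> \<preceq> x" using inv_le[OF inv_le_l_abs[of x]] assms by simp
qed (use assms in auto)

section \<open>Disjoint elements and polars\<close>

text \<open>The meet \<open>z\<close> of \<open>u \<otimes> v\<close> and \<open>w\<close> is below
  \<open>w\<close>, hence below \<open>u \<otimes> w\<close> because \<open>u\<close> is at least
  the identity. So \<open>z\<close> is below the meet of \<open>u \<otimes> v\<close> and
  \<open>u \<otimes> w\<close>, which is \<open>u\<close> times the trivial meet of \<open>v\<close>
  and \<open>w\<close>. Being below \<open>u\<close> and \<open>w\<close>, it is at most the
  identity.\<close>

lemma wedge_mult_eq_one: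
  assumes "u \<^bold>\<and> w = \<one>" "v \<^bold>\<and> w = \<one>" "\<one> \<preceq> u" "\<one> \<preceq> v" "\<one> \<preceq> w"
    and c: "u \<in> carrier L" "v \<in> carrier L" "w \<in> carrier L"
  shows "u \<otimes> v \<^bold>\<and> w = \<one>"
proof (rule le_antisym)
  let ?z = "u \<otimes> v \<^bold>\<and> w"
  have zw: "?z \<preceq> w" using c by (simp add: wedge_le2)
  have "?z \<preceq> u \<otimes> w"
    using le_trans[OF zw le_mult_left[of u w]] assms by simp
  then have "?z \<preceq> u \<otimes> v \<^bold>\<and> u \<otimes> w"
    using c by (intro le_wedge) (auto simp: wedge_le1)
  then have "?z \<preceq> u"
    using assms by (simp add: mult_wedge_distrib_left[symmetric])
  then have "?z \<preceq> u \<^bold>\<and> w"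
    using c zw by (intro le_wedge) auto
  then show "?z \<preceq> \<one>" using assms by simp
  have "\<one> \<preceq> u \<otimes> v"
    using mult_le_mono[of \<one> u \<one> v] assms by simp
  then show "\<one> \<preceq> ?z"
    using assms by (intro le_wedge) auto
qed (use c in auto)

text \<open>The bound \<open>u\<close> dominates \<open>l_abs L x\<close>, so the meet of
  \<open>l_abs L x\<close> with \<open>l_abs L s\<close> is squeezed between the identity and the
  trivial meet of \<open>u\<close> with \<open>l_abs L s\<close>. Membership in a polar can thus be
  tested on any convenient bound.\<close>

lemma polarI:
  assumes "x \<in> carrier L" "u \<in> carrier L" "S \<subseteq> carrier L" "x \<preceq> u" "inv x \<preceq> u"
    and u: "\<And>s. s \<in> S \<Longrightarrow> u \<^bold>\<and> l_abs L s = \<one>"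
  shows "x \<in> polar L S"
proof -
  have "l_abs L x \<^bold>\<and> l_abs L s = \<one>" if s: "s \<in> S" for s
  proof (rule le_antisym)
    have sL: "s \<in> carrier L" using assms s by blast
    have "l_abs L x \<^bold>\<and> l_abs L s \<preceq> u"
      using le_trans[OF wedge_le1 l_abs_le[of x u]] assms sL by simp
    then have "l_abs L x \<^bold>\<and> l_abs L s \<preceq> u \<^bold>\<and> l_abs L s"
      using assms sL by (intro le_wedge) (auto simp: wedge_le2)
    then show "l_abs L x \<^bold>\<and> l_abs L s \<preceq> \<one>" using u s by simp
    show "\<one> \<preceq> l_abs L x \<^bold>\<and> l_abs L s"
      using assms sL by (intro le_wedge one_le_l_abs) auto
  qed (use assms s in auto)
  then show ?thesis using assms by (simp add: polar_def)
qed

text \<open>By \<open>wedge_mult_eq_one\<close> the product of the two absolute values is again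
  disjoint from every element of \<open>S\<close>, so it can serve as the bound in
  \<open>polarI\<close>.\<close>

lemma polar_le:
  assumes "x \<in> carrier L" "S \<subseteq> carrier L" "a \<in> polar L S" "b \<in> polar L S"
    and "x \<preceq> l_abs L a \<otimes> l_abs L b" "inv x \<preceq> l_abs L a \<otimes> l_abs L b"
  shows "x \<in> polar L S"
proof (rule polarI[where u = "l_abs L a \<otimes> l_abs L b"])
  fix s assume "s \<in> S"
  with assms show "l_abs L a \<otimes> l_abs L b \<^bold>\<and> l_abs L s = \<one>"
    by (intro wedge_mult_eq_one) (auto simp: polar_def intro: one_le_l_abs)
qed (use assms in \<open>auto simp: polar_def\<close>)

lemma polar_mult_closed:
  assumes S: "S \<subseteq> carrier L" and ab: "a \<in> polar L S" "b \<in> polar L S"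
  shows "a \<otimes> b \<in> polar L S"
proof -
  let ?a = "l_abs L a" and ?b = "l_abs L b"
  have c: "a \<in> carrier L" "b \<in> carrier L" using ab by (auto simp: polar_def)
  have pos: "\<one> \<preceq> ?a" "\<one> \<preceq> ?b" using c by (auto intro: one_le_l_abs)
  show ?thesis
  \<comment> \<open>\<open>|a| |b| |a|\<close> is above both \<open>|a| |b|\<close> and \<open>|b| |a|\<close>, which need not agree.\<close>
  proof (rule polarI[where u = "?a \<otimes> (?b \<otimes> ?a)"])
    have "a \<otimes> b \<preceq> ?a \<otimes> ?b" using c by (intro mult_le_mono le_l_abs) auto
    moreover have "?a \<otimes> ?b \<preceq> ?a \<otimes> (?b \<otimes> ?a)"
      using c pos by (intro mult_le_left le_mult_right) auto
    ultimately show "a \<otimes> b \<preceq> ?a \<otimes> (?b \<otimes> ?a)" by (rule le_trans) (use c in auto)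
    have "inv b \<otimes> inv a \<preceq> ?b \<otimes> ?a" using c by (intro mult_le_mono inv_le_l_abs) auto
    moreover have "?b \<otimes> ?a \<preceq> ?a \<otimes> (?b \<otimes> ?a)"
      using c pos by (intro le_mult_left) auto
    ultimately have "inv b \<otimes> inv a \<preceq> ?a \<otimes> (?b \<otimes> ?a)"
      by (rule le_trans) (use c in auto)
    then show "inv (a \<otimes> b) \<preceq> ?a \<otimes> (?b \<otimes> ?a)" using c by (simp add: inv_mult_group)
    fix s assume "s \<in> S"
    then have s: "\<one> \<preceq> l_abs L s" "?a \<^bold>\<and> l_abs L s = \<one>" "?b \<^bold>\<and> l_abs L s = \<one>" "s \<in> carrier L"
      using S ab by (auto simp: polar_def intro: one_le_l_abs)
    \<comment> \<open>Disjointness passes to the threefold product by two uses of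
      \<open>wedge_mult_eq_one\<close>; the outer one needs the inner product to be at least the
      identity.\<close>
    have "\<one> \<preceq> ?b \<otimes> ?a" using mult_le_mono[of \<one> ?b \<one> ?a] pos c by simp
    then show "?a \<otimes> (?b \<otimes> ?a) \<^bold>\<and> l_abs L s = \<one>"
      using s c pos by (intro wedge_mult_eq_one) auto
  qed (use S c in auto)
qed

lemma l_abs_conj:
  assumes "g \<in> carrier L" "x \<in> carrier L"
  shows "l_abs L (g \<otimes> x \<otimes> inv g) = g \<otimes> l_abs L x \<otimes> inv g"
  using assms
  by (simp add: l_abs_def mult_vee_distrib_left mult_vee_distrib_right inv_mult_group m_assoc)

text \<open>Conjugation by \<open>g\<close> is an automorphism that commutes with meets and absolute
  values. Meeting the conjugate of \<open>x\<close> with \<open>s\<close> therefore amounts to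
  meeting \<open>x\<close> with \<open>inv g \<otimes> s \<otimes> g\<close>, which is again in
  \<open>S\<close>, and conjugating the result.\<close>

lemma polar_conj:
  assumes S: "S \<subseteq> carrier L"
    and S_conj: "\<And>g s. \<lbrakk>g \<in> carrier L; s \<in> S\<rbrakk> \<Longrightarrow> g \<otimes> s \<otimes> inv g \<in> S"
    and g: "g \<in> carrier L" and x: "x \<in> polar L S"
  shows "g \<otimes> x \<otimes> inv g \<in> polar L S"
proof -
  have xL: "x \<in> carrier L" using x by (simp add: polar_def)
  have "l_abs L (g \<otimes> x \<otimes> inv g) \<^bold>\<and> l_abs L s = \<one>" if s: "s \<in> S" for s
  proof -
    let ?t = "inv g \<otimes> s \<otimes> g"
    have c: "s \<in> carrier L" using S s by blast
    have "?t \<in> S" using S_conj[of "inv g" s] g s by simp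
    then have *: "l_abs L x \<^bold>\<and> l_abs L ?t = \<one>" using x by (simp add: polar_def)
    have "g \<otimes> ?t \<otimes> inv g = s"
      using g c by (simp add: m_assoc) (simp add: m_assoc[symmetric])
    then have "l_abs L s = g \<otimes> l_abs L ?t \<otimes> inv g"
      using l_abs_conj[of g ?t] g c by simp
    then have "l_abs L (g \<otimes> x \<otimes> inv g) \<^bold>\<and> l_abs L s = g \<otimes> (l_abs L x \<^bold>\<and> l_abs L ?t) \<otimes> inv g"
      using g c xL by (simp add: l_abs_conj mult_wedge_distrib_left mult_wedge_distrib_right)
    then show ?thesis using * g by simp
  qed
  then show ?thesis using g xL by (simp add: polar_def)
qed

text \<open>Normality of \<open>S\<close> provides the invariance under conjugation that
  \<open>polar_conj\<close> asks for. Closure under joins and convexity are both instances of the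
  local fact \<open>between\<close>.\<close>

lemma convex_normal_subalgebra_polar:
  assumes "S \<lhd> L"
  shows "convex_normal_subalgebra (polar L S) L"
proof -
  interpret S: normal S L by fact
  have S: "S \<subseteq> carrier L" by (rule S.subset)
  \<comment> \<open>Each factor lies below the product of the two absolute values because the other
    factor is at least the identity, so this product bounds both.\<close>
  have le_left: "x \<preceq> l_abs L a \<otimes> l_abs L b"
    if "x \<preceq> l_abs L a" "x \<in> carrier L" "a \<in> carrier L" "b \<in> carrier L" for x a b
    using le_trans[OF that(1) le_mult_right[OF one_le_l_abs]] that by simp
  have le_right: "x \<preceq> l_abs L a \<otimes> l_abs L b"
    if "x \<preceq> l_abs L b" "x \<in> carrier L" "a \<in> carrier L" "b \<in> carrier L" for x a b
    using le_trans[OF that(1) le_mult_left[OF one_le_l_abs]] that by simp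
  \<comment> \<open>Only an upper bound on \<open>x\<close> has to be supplied: inverting the lower
    bound \<open>a \<preceq> x\<close> gives \<open>inv x \<preceq> inv a\<close>, and
    \<open>inv a\<close> lies below \<open>l_abs L a\<close>.\<close>
  have between: "x \<in> polar L S"
    if ab: "a \<in> polar L S" "b \<in> polar L S" and x: "x \<in> carrier L" "a \<preceq> x"
      "x \<preceq> l_abs L a \<otimes> l_abs L b" for a b x
  proof (rule polar_le[OF x(1) S ab x(3)])
    have c: "a \<in> carrier L" "b \<in> carrier L" using ab by (auto simp: polar_def)
    have "inv x \<preceq> l_abs L a"
      using le_trans[OF inv_le[OF x(2)] inv_le_l_abs[of a]] c x by simp
    then show "inv x \<preceq> l_abs L a \<otimes> l_abs L b" using c x by (intro le_left) auto
  qed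
  have one: "\<one> \<in> polar L S"
  proof -
    have "\<one> \<^bold>\<and> l_abs L s = \<one>" if "s \<in> S" for s
      using that S by (intro le_antisym le_wedge wedge_le1) (auto intro: one_le_l_abs)
    then show ?thesis using S by (intro polarI[where u = \<one>]) auto
  qed
  have "subgroup (polar L S) L"
  proof
    show "polar L S \<subseteq> carrier L" by (auto simp: polar_def)
    show "a \<otimes> b \<in> polar L S" if "a \<in> polar L S" "b \<in> polar L S" for a b
      using S that by (rule polar_mult_closed)
    show "inv a \<in> polar L S" if "a \<in> polar L S" for a
      using that by (simp add: polar_def l_abs_inv)
  qed (rule one)
  then have "polar L S \<lhd> L"
    using polar_conj[OF S S.inv_op_closed2] by (simp add: normal_inv_iff)
  moreover have "a \<^bold>\<or> b \<in> polar L S" if ab: "a \<in> polar L S" "b \<in> polar L S" for a b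
  proof (rule between[OF ab])
    have c: "a \<in> carrier L" "b \<in> carrier L" using ab by (auto simp: polar_def)
    show "a \<^bold>\<or> b \<in> carrier L" "a \<preceq> a \<^bold>\<or> b" using c by (auto intro: le_vee1)
    show "a \<^bold>\<or> b \<preceq> l_abs L a \<otimes> l_abs L b"
      using c by (intro vee_le le_left[OF le_l_abs] le_right[OF le_l_abs]) auto
  qed
  moreover have "x \<in> polar L S"
    if ab: "a \<in> polar L S" "b \<in> polar L S" and x: "x \<in> carrier L" "a \<preceq> x" "x \<preceq> b" for a b x
  proof (rule between[OF ab x(1,2)])
    have c: "a \<in> carrier L" "b \<in> carrier L" using ab by (auto simp: polar_def)
    have "x \<preceq> l_abs L b" using le_trans[OF x(3) le_l_abs] c x by simp
    then show "x \<preceq> l_abs L a \<otimes> l_abs L b" using c x by (intro le_right) auto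
  qed
  ultimately show ?thesis unfolding convex_normal_subalgebra_def by blast
qed

text \<open>Testing \<open>x\<close> against itself gives that the meet of \<open>l_abs L x\<close>
  with itself, which is \<open>l_abs L x\<close>, is the identity.\<close>

lemma polar_disjoint:
  assumes "x \<in> S" "x \<in> polar L S"
  shows "x = \<one>"
proof (rule l_abs_eq_one)
  show x: "x \<in> carrier L" using assms by (simp add: polar_def)
  have "l_abs L x \<^bold>\<and> l_abs L x = \<one>" using assms unfolding polar_def by blast
  then show "l_abs L x = \<one>" using x by simp
qed

end

section \<open>Intersections and preimages of ideals\<close>

lemma convex_normal_subalgebra_Int:
  assumes "l_group A" "convex_normal_subalgebra I A" "convex_normal_subalgebra J A"
  shows "convex_normal_subalgebra (I \<inter> J) A"
proof -
  interpret l_group A by fact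
  have "I \<inter> J \<lhd> A"
    using assms unfolding convex_normal_subalgebra_def by (intro normal_subgroup_intersect) auto
  then show ?thesis using assms unfolding convex_normal_subalgebra_def by blast
qed

lemma l_hom_comp: "f \<in> l_hom A B \<Longrightarrow> g \<in> l_hom B C \<Longrightarrow> g \<circ> f \<in> l_hom A C"
  by (auto simp: l_hom_def hom_def Pi_iff)

text \<open>The preimage is the kernel of \<open>h\<close> followed by the quotient map of
  \<open>B\<close> modulo \<open>J\<close>, and kernels have the required closure
  properties.\<close>

lemma convex_normal_subalgebra_vimage:
  assumes A: "l_group A" and B: "l_group B" and h: "h \<in> l_hom A B"
    and J: "convex_normal_subalgebra J B"
  shows "convex_normal_subalgebra {x \<in> carrier A. h x \<in> J} A"
proof -
  note Q = l_quotient[OF B J]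
  let ?c = "\<lambda>x. J #>\<^bsub>B\<^esub> x"
  have "{x \<in> carrier A. h x \<in> J} = {x \<in> carrier A. h x \<in> kernel B (l_quotient B J) ?c}"
    unfolding Q(3) ..
  also have "\<dots> = kernel A (l_quotient B J) (?c \<circ> h)"
    using l_homD(2)[OF h] by (auto simp: kernel_def)
  finally show ?thesis
    using convex_normal_subalgebra_kernel[OF A Q(1) l_hom_comp[OF h Q(2)]] by simp
qed

section \<open>The ideal attached to a split extension\<close>

theorem mainTheorem13:
  fixes X :: "('x, 'l) lgroup_scheme" and A :: "('a, 'm) lgroup_scheme"
    and B :: "('b, 'n) lgroup_scheme"
    and k :: "'x \<Rightarrow> 'a" and p :: "'a \<Rightarrow> 'b" and s :: "'b \<Rightarrow> 'a"
  assumes "split_extension X A B k p s"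
  shows "l_ideal (polar A (k ` carrier X) \<inter> s ` carrier B) A"
proof -
  have A: "l_group A" and B: "l_group B" and p: "p \<in> l_hom A B" and s: "s \<in> l_hom B A"
    and ps: "\<And>b. b \<in> carrier B \<Longrightarrow> p (s b) = b" and im: "k ` carrier X = kernel A B p"
    using assms by (auto simp: split_extension_def is_kernel_def)
  interpret A: l_group A by fact
  interpret p: group_hom A B p using A B p by (rule l_hom_group_hom)
  let ?K = "kernel A B p"
  let ?J = "polar A ?K"
  have J: "convex_normal_subalgebra ?J A"
    by (rule A.convex_normal_subalgebra_polar[OF p.normal_kernel])
  interpret J: normal ?J A using J unfolding convex_normal_subalgebra_def by blast
  have spx_eq: "s (p x) = x" if x: "x \<in> ?J" and spx: "s (p x) \<in> ?J" for x
  proof -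
    have c: "x \<in> carrier A" "p x \<in> carrier B" "s (p x) \<in> carrier A"
      using J.mem_carrier[OF x] J.mem_carrier[OF spx] by simp_all
    \<comment> \<open>Since \<open>p\<close> sends both \<open>x\<close> and \<open>s (p x)\<close>
      to \<open>p x\<close>, it sends this element to the identity.\<close>
    have "x \<otimes>\<^bsub>A\<^esub> inv\<^bsub>A\<^esub> s (p x) \<in> ?K"
      using c by (simp add: kernel_def ps)
    moreover have "x \<otimes>\<^bsub>A\<^esub> inv\<^bsub>A\<^esub> s (p x) \<in> ?J"
      using x spx by simp
    ultimately have "x \<otimes>\<^bsub>A\<^esub> inv\<^bsub>A\<^esub> s (p x) = \<one>\<^bsub>A\<^esub>"
      by (rule A.polar_disjoint)
    then show ?thesis
      using c A.inv_solve_right[of "\<one>\<^bsub>A\<^esub>" x "s (p x)"] by simp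
  qed
  \<comment> \<open>If \<open>x\<close> is \<open>s b\<close>, then \<open>s (p x)\<close> is
    \<open>x\<close> itself, so it lies in the polar when \<open>x\<close> does. Conversely,
    \<open>spx_eq\<close> exhibits \<open>x\<close> as the image of \<open>p x\<close> under
    \<open>s\<close>.\<close>
  have "?J \<inter> s ` carrier B = ?J \<inter> {x \<in> carrier A. (s \<circ> p) x \<in> ?J}"
  proof (intro equalityI subsetI)
    fix x assume "x \<in> ?J \<inter> s ` carrier B"
    then show "x \<in> ?J \<inter> {x \<in> carrier A. (s \<circ> p) x \<in> ?J}"
      by (elim IntE imageE) (simp add: ps)
  next
    fix x assume "x \<in> ?J \<inter> {x \<in> carrier A. (s \<circ> p) x \<in> ?J}"
    then have "x \<in> ?J" "p x \<in> carrier B" "s (p x) = x"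
      by (simp_all add: spx_eq)
    then show "x \<in> ?J \<inter> s ` carrier B"
      by (metis IntI imageI)
  qed
  \<comment> \<open>The second set is the preimage of an ideal under the endomorphism
    \<open>s \<circ> p\<close> of \<open>A\<close>.\<close>
  moreover have "convex_normal_subalgebra (?J \<inter> {x \<in> carrier A. (s \<circ> p) x \<in> ?J}) A"
    using convex_normal_subalgebra_Int[OF A J]
      convex_normal_subalgebra_vimage[OF A A l_hom_comp[OF p s] J] .
  ultimately show ?thesis
    by (simp add: im l_ideal_iff[OF A])
qed

end
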